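(* (Relative tightness.) Let $\Phi,\Psi$ be semantic assertions and $C$ a pwhile command such that the specification $\{\Phi\}\,C\,\{\Psi\}$ is partially correct. Let $\Sigma:\Omega\to\mathsf{State}$ be a random state with $(\Sigma\models\Phi)=\mathsf{tt}$, and suppose the random configuration $C,\Sigma$ is terminating. Then \[ \Sigma_{C,\Sigma}^{\mathrm{T}}|_{\mathrm{FV}(\Psi)} \;\perp\!\!\!\perp\; \Sigma\circ q_{C,\Sigma} \;\mid\; \Sigma|_{\mathrm{FV}(\Phi)}\circ q_{C,\Sigma}, \] where $\Sigma^{\mathrm{T}}_{C,\Sigma}$ denotes the termination random state $\mathrm{T}_{C,\Sigma}$; that is, $\mathrm{T}_{C,\Sigma}|_{\mathrm{FV}(\Psi)}$ is conditionally independent of $\Sigma\circ q_{C,\Sigma}$ given $\Sigma|_{\mathrm{FV}(\Phi)}\circ q_{C,\Sigma}$ (all three being random variables on the sample space $\Omega_{C,\Sigma}$).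
   Context: States and random states. Fix an infinite set $\mathsf{Var}$ of program variables. A state is a finite partial function $\sigma:\mathsf{Var}\rightharpoonup\mathbb{Z}$ with (finite) domain $\mathsf{Dom}(\sigma)$; $\mathsf{State}$ is the set of states, ordered by $\sigma\sqsubseteq\sigma'$ iff $\sigma'$ agrees with $\sigma$ on $\mathsf{Dom}(\sigma)$. For $V\subseteq\mathsf{Var}$, the restriction $\sigma|_V$ is the state with $\sigma|_V(X)=\sigma(X)$ if $X\in V\cap\mathsf{Dom}(\sigma)$ and undefined otherwise; $\sigma$ is $V$-total if $V\subseteq\mathsf{Dom}(\sigma)$. A sample space is a countable set $\Omega$ with a probability distribution $p_\Omega$ such that $p_\Omega(\omega)>0$ for all $\omega$. A morphism of sample spaces $q:\Omega'\to\Omega$ is a function whose pushforward of $p_{\Omega'}$ is $p_\Omega$. A random variable is a function $S:\Omega\to A$; its distribution $p_S$ is the pushforward of $p_\Omega$, and $\mathsf{Supp}(S)=\{a: p_S(a)>0\}$. $S:\Omega\to A$, $T:\Omega\to B$ are independent ($S\perp\!\!\!\perp T$) if $p_{(S,T)}(a,b)=p_S(a)p_T(b)$ for all $a,b$. For $a\in\mathsf{Supp}(S)$, the conditioned random variable $T_{|S=a}$ is $T$ restricted to $\Omega_{|S=a}=\{\omega: S(\omega)=a\}$ with distribution $p_\Omega(\omega)/p_S(a)$. $S\perp\!\!\!\perp T\mid U$ means $S_{|U=c}\perp\!\!\!\perp T_{|U=c}$ for all $c\in\mathsf{Supp}(U)$. A random state is a random variable $\Sigma:\Omega\to\mathsf{State}$;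 $\Sigma\sqsubseteq\Sigma'$ (same $\Omega$) pointwise; $\Sigma|_V(\omega)=\Sigma(\omega)|_V$; $\Sigma$ is $V$-total if $\Sigma(\omega)$ is $V$-total with probability 1. Language. Commands: $C::= X:=E \mid X\xleftarrow{\$}D \mid \mathsf{skip}\mid C;C\mid \mathsf{if}\ B\ \mathsf{then}\ C\ \mathsf{else}\ C\mid \mathsf{while}\ B\ \mathsf{do}\ C$, where $E$ are integer expressions, $B$ boolean expressions and $D$ distribution expressions (denoting discrete probability distributions on $\mathbb{Z}$), each with a finite set of variables $\mathsf{Var}(\cdot)$; the value $[\![E]\!]_\sigma$ (resp. $[\![B]\!]_\sigma$, $[\![D]\!]_\sigma$) is defined iff its variables lie in $\mathsf{Dom}(\sigma)$. Operational semantics: nodes are nonterminal configurations $C,\sigma$, terminal configurations $\sigma$, and $\mathsf{fault}$; transitions are unlabelled or labelled by $(n,d)$ with $d$ a distribution on $\mathbb{Z}$, $n\in\mathsf{Supp}(d)$. Rules: $X:=E,\sigma\to\sigma[X\mapsto[\![E]\!]_\sigma]$ if defined, else $\to\mathsf{fault}$; $X\xleftarrow{\$}D,\sigma\xrightarrow{(n,d)}\sigma[X\mapsto n]$ for $d=[\![D]\!]_\sigma$, $n\in\mathsf{Supp}(d)$, if defined, else $\to\mathsf{fault}$; $\mathsf{skip},\sigma\to\sigma$; if $C_1,\sigma\xrightarrow{L}C_1',\sigma'$ then $C_1;C_2,\sigma\xrightarrow{L}C_1';C_2,\sigma'$; if $C_1,\sigma\xrightarrow{L}\sigma'$ then $C_1;C_2,\sigma\xrightarrow{L}C_2,\sigma'$;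 if $C_1,\sigma\to\mathsf{fault}$ then $C_1;C_2,\sigma\to\mathsf{fault}$; $\mathsf{if}\ B\ \mathsf{then}\ C_1\ \mathsf{else}\ C_2,\sigma$ steps to $C_1,\sigma$ if $[\![B]\!]_\sigma=\mathsf{tt}$, to $C_2,\sigma$ if $\mathsf{ff}$, to $\mathsf{fault}$ if undefined; $\mathsf{while}\ B\ \mathsf{do}\ C,\sigma$ steps to $\sigma$ if $[\![B]\!]_\sigma=\mathsf{ff}$, to $C;\mathsf{while}\ B\ \mathsf{do}\ C,\sigma$ if $\mathsf{tt}$, to $\mathsf{fault}$ if undefined. A terminal path from $C,\sigma$ is a finite path of nonterminal configurations ending in a terminal configuration $\tau=\mathsf{final}(\pi)$; its probability $\mathsf{Pr}(\pi)$ is the product of $d(n)$ over its labelled transitions. $C,\sigma$ is terminating if the probabilities of all terminal paths sum to 1, and fault-free if $\mathsf{fault}$ is not reachable from it. For a random state $\Sigma:\Omega\to\mathsf{State}$, $C,\Sigma$ is fault-free (resp. terminating) if $C,\Sigma(\omega)$ is so for all $\omega\in\Omega$. If $C,\Sigma$ is terminating, let $\Omega_{C,\Sigma}=\{(\omega,\pi):\omega\in\Omega,\ \pi$ a terminal path from $C,\Sigma(\omega)\}$ with $p(\omega,\pi)=p_\Omega(\omega)\mathsf{Pr}(\pi)$; $q_{C,\Sigma}(\omega,\pi)=\omega$ (a sample space morphism) and $\mathrm{T}_{C,\Sigma}(\omega,\pi)=\mathsf{final}(\pi)$. Assertions. A semantic assertion $\Phi$ is a partial function $\Sigma\mapsto(\Sigma\models\Phi)\in\{\mathsf{tt},\mathsf{ff}\}$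 on random states such that: (SA1) if $\Sigma\sqsubseteq\Sigma'$ and $\Sigma\models\Phi$ is defined then $(\Sigma\models\Phi)=(\Sigma'\models\Phi)$; (SA2) there is a finite set $\mathrm{FV}(\Phi)\subseteq\mathsf{Var}$ such that $\Sigma\models\Phi$ is defined iff $\Sigma$ is $\mathrm{FV}(\Phi)$-total; (SA3) for every sample-space morphism $q:\Omega'\to\Omega$, $(\Sigma\circ q\models\Phi)=(\Sigma\models\Phi)$. We write $\Sigma\models\Phi$ for $(\Sigma\models\Phi)=\mathsf{tt}$. Specifications. $\{\Phi\}\,C\,\{\Psi\}$ is partially correct if for every random state $\Sigma$ with $\Sigma\models\Phi$: $C,\Sigma$ is fault-free, and if $C,\Sigma$ is terminating then $\mathrm{T}_{C,\Sigma}\models\Psi$. *)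

theory Defs
  imports "HOL-Probability.Probability" "HOL-Library.Finite_Map"
begin

text \<open>Sample spaces, random variables and conditional independence.

  A sample space is given by a probability mass function \<open>p\<close>; its carrier is the set
  \<open>set_pmf p\<close>, which is countable and on which \<open>p\<close> is strictly positive. A random variable is a
  function on the ambient type, only its values on \<open>set_pmf p\<close> being relevant. Its distribution is
  \<open>map_pmf S p\<close> and its support is \<open>set_pmf (map_pmf S p)\<close>.\<close>

definition indep_rv :: "'w pmf \<Rightarrow> ('w \<Rightarrow> 'a) \<Rightarrow> ('w \<Rightarrow> 'b) \<Rightarrow> bool" where
  "indep_rv p S T \<longleftrightarrow>
     (\<forall>a b. pmf (map_pmf (\<lambda>w. (S w, T w)) p) (a, b) = pmf (map_pmf S p) a * pmf (map_pmf T p) b)"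

definition cond_indep_rv :: "'w pmf \<Rightarrow> ('w \<Rightarrow> 'a) \<Rightarrow> ('w \<Rightarrow> 'b) \<Rightarrow> ('w \<Rightarrow> 'c) \<Rightarrow> bool" where
  "cond_indep_rv p S T U \<longleftrightarrow>
     (\<forall>c \<in> set_pmf (map_pmf U p). indep_rv (cond_pmf p {w. U w = c}) S T)"

definition sample_morphism :: "('w \<Rightarrow> 'u) \<Rightarrow> 'w pmf \<Rightarrow> 'u pmf \<Rightarrow> bool" where
  "sample_morphism q p' p \<longleftrightarrow> map_pmf q p' = p"


text \<open>States; \<open>\<sigma> \<sqsubseteq> \<sigma>'\<close> is \<^const>\<open>fmsubset\<close> and \<open>\<sigma>|\<^sub>V\<close> is \<^const>\<open>fmrestrict_set\<close>.\<close>

type_synonym 'v state = "('v, int) fmap"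

definition total_state :: "'v set \<Rightarrow> 'v state \<Rightarrow> bool" where
  "total_state V \<sigma> \<longleftrightarrow> V \<subseteq> fmdom' \<sigma>"

definition total_rs :: "'v set \<Rightarrow> 'w pmf \<Rightarrow> ('w \<Rightarrow> 'v state) \<Rightarrow> bool" where
  "total_rs V p S \<longleftrightarrow> (AE w in measure_pmf p. total_state V (S w))"


text \<open>Expressions are identified with their finite variable set together with their denotation.
  The denotation is defined exactly on the states whose domain contains the variables, and depends
  only on the values of these variables.\<close>

typedef ('v, 'a) expr =
  "{(V :: 'v set, f :: 'v state \<Rightarrow> 'a option).
      finite V \<and>
      (\<forall>\<sigma>. f \<sigma> \<noteq> None \<longleftrightarrow> V \<subseteq> fmdom' \<sigma>) \<and>
      (\<forall>\<sigma> \<sigma>'. fmrestrict_set V \<sigma> = fmrestrict_set V \<sigma>' \<longrightarrow> f \<sigma> = f \<sigma>')}"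
  by (rule exI[of _ "({}, \<lambda>_. Some undefined)"]) auto

definition expr_vars :: "('v, 'a) expr \<Rightarrow> 'v set" where
  "expr_vars E = fst (Rep_expr E)"

definition expr_eval :: "('v, 'a) expr \<Rightarrow> 'v state \<Rightarrow> 'a option" where
  "expr_eval E = snd (Rep_expr E)"

datatype 'v com =
    Assign 'v "('v, int) expr"
  | Sample 'v "('v, int pmf) expr"
  | Skip
  | Seq "'v com" "'v com"
  | Cond "('v, bool) expr" "'v com" "'v com"
  | While "('v, bool) expr" "'v com"

datatype 'v config = Running "'v com" "'v state" | Terminal "'v state" | Fault

text \<open>\<^const>\<open>None\<close> for unlabelled transitions.\<close>

type_synonym label = "(int \<times> int pmf) option"

inductive step :: "'v config \<Rightarrow> label \<Rightarrow> 'v config \<Rightarrow> bool" where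
  Assign: "expr_eval E \<sigma> = Some n \<Longrightarrow>
     step (Running (Assign X E) \<sigma>) None (Terminal (fmupd X n \<sigma>))"
| AssignFault: "expr_eval E \<sigma> = None \<Longrightarrow> step (Running (Assign X E) \<sigma>) None Fault"
| Sample: "expr_eval D \<sigma> = Some d \<Longrightarrow> n \<in> set_pmf d \<Longrightarrow>
     step (Running (Sample X D) \<sigma>) (Some (n, d)) (Terminal (fmupd X n \<sigma>))"
| SampleFault: "expr_eval D \<sigma> = None \<Longrightarrow> step (Running (Sample X D) \<sigma>) None Fault"
| Skip: "step (Running Skip \<sigma>) None (Terminal \<sigma>)"
| SeqRunning: "step (Running C1 \<sigma>) L (Running C1' \<sigma>') \<Longrightarrow>
     step (Running (Seq C1 C2) \<sigma>) L (Running (Seq C1' C2) \<sigma>')"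
| SeqTerminal: "step (Running C1 \<sigma>) L (Terminal \<sigma>') \<Longrightarrow>
     step (Running (Seq C1 C2) \<sigma>) L (Running C2 \<sigma>')"
| SeqFault: "step (Running C1 \<sigma>) None Fault \<Longrightarrow> step (Running (Seq C1 C2) \<sigma>) None Fault"
| IfTrue: "expr_eval B \<sigma> = Some True \<Longrightarrow> step (Running (Cond B C1 C2) \<sigma>) None (Running C1 \<sigma>)"
| IfFalse: "expr_eval B \<sigma> = Some False \<Longrightarrow> step (Running (Cond B C1 C2) \<sigma>) None (Running C2 \<sigma>)"
| IfFault: "expr_eval B \<sigma> = None \<Longrightarrow> step (Running (Cond B C1 C2) \<sigma>) None Fault"
| WhileFalse: "expr_eval B \<sigma> = Some False \<Longrightarrow> step (Running (While B C) \<sigma>) None (Terminal \<sigma>)"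
| WhileTrue: "expr_eval B \<sigma> = Some True \<Longrightarrow>
     step (Running (While B C) \<sigma>) None (Running (Seq C (While B C)) \<sigma>)"
| WhileFault: "expr_eval B \<sigma> = None \<Longrightarrow> step (Running (While B C) \<sigma>) None Fault"

text \<open>A path is the list of its transitions (source, label, target). Since terminal configurations
  and \<^const>\<open>Fault\<close> have no outgoing transition, all sources are nonterminal configurations.\<close>

type_synonym 'v cpath = "('v config \<times> label \<times> 'v config) list"

inductive term_path :: "'v config \<Rightarrow> 'v cpath \<Rightarrow> bool" where
  last: "step c L (Terminal \<tau>) \<Longrightarrow> term_path c [(c, L, Terminal \<tau>)]"
| step: "step c L c' \<Longrightarrow> term_path c' \<pi> \<Longrightarrow> term_path c ((c, L, c') # \<pi>)"

definition term_paths :: "'v com \<Rightarrow> 'v state \<Rightarrow> 'v cpath set" where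
  "term_paths C \<sigma> = {\<pi>. term_path (Running C \<sigma>) \<pi>}"

fun label_prob :: "label \<Rightarrow> real" where
  "label_prob None = 1"
| "label_prob (Some (n, d)) = pmf d n"

definition path_prob :: "'v cpath \<Rightarrow> real" where
  "path_prob \<pi> = (\<Prod>(c, L, c') \<leftarrow> \<pi>. label_prob L)"

definition final :: "'v cpath \<Rightarrow> 'v state" where
  "final \<pi> = (THE \<tau>. snd (snd (last \<pi>)) = Terminal \<tau>)"

definition terminating :: "'v com \<Rightarrow> 'v state \<Rightarrow> bool" where
  "terminating C \<sigma> \<longleftrightarrow> (path_prob has_sum 1) (term_paths C \<sigma>)"

definition fault_free :: "'v com \<Rightarrow> 'v state \<Rightarrow> bool" where
  "fault_free C \<sigma> \<longleftrightarrow> \<not> (\<lambda>c c'. \<exists>L. step c L c')\<^sup>*\<^sup>* (Running C \<sigma>) Fault"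

definition terminating_rs :: "'v com \<Rightarrow> 'w pmf \<Rightarrow> ('w \<Rightarrow> 'v state) \<Rightarrow> bool" where
  "terminating_rs C p S \<longleftrightarrow> (\<forall>w \<in> set_pmf p. terminating C (S w))"

definition fault_free_rs :: "'v com \<Rightarrow> 'w pmf \<Rightarrow> ('w \<Rightarrow> 'v state) \<Rightarrow> bool" where
  "fault_free_rs C p S \<longleftrightarrow> (\<forall>w \<in> set_pmf p. fault_free C (S w))"


text \<open>The termination sample space \<open>\<Omega>\<^bsub>C,\<Sigma>\<^esub>\<close>, meaningful for terminating random configurations only
  (see \<open>pmf_term_space\<close> and \<open>set_pmf_term_space\<close> below).\<close>

definition term_space :: "'v com \<Rightarrow> 'w pmf \<Rightarrow> ('w \<Rightarrow> 'v state) \<Rightarrow> ('w \<times> 'v cpath) pmf" where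
  "term_space C p S =
     embed_pmf (\<lambda>(w, \<pi>). if \<pi> \<in> term_paths C (S w) then pmf p w * path_prob \<pi> else 0)"

definition term_proj :: "'w \<times> 'v cpath \<Rightarrow> 'w" where
  "term_proj = (\<lambda>(w, \<pi>). w)"

definition term_rs :: "'w \<times> 'v cpath \<Rightarrow> 'v state" where
  "term_rs = (\<lambda>(w, \<pi>). final \<pi>)"

lemma path_prob_pos:
  assumes "term_path c \<pi>" shows "path_prob \<pi> > 0"
proof -
  have lab: "label_prob L > 0" if "step c L c'" for c :: "'v config" and L c'
    using that by (induction rule: step.induct) (auto simp: pmf_positive)
  show ?thesis
    using assms by (induction rule: term_path.induct) (auto simp: path_prob_def lab)
qed

lemma path_prob_nn_integral:
  assumes "terminating C \<sigma>"
  shows "(\<integral>\<^sup>+\<pi>. ennreal (path_prob \<pi>) * indicator (term_paths C \<sigma>) \<pi> \<partial>count_space UNIV) = 1"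
proof -
  let ?A = "term_paths C \<sigma>"
  have pos: "\<And>\<pi>. \<pi> \<in> ?A \<Longrightarrow> path_prob \<pi> \<ge> 0"
    using path_prob_pos by (fastforce simp: term_paths_def intro: less_imp_le)
  have hs: "(path_prob has_sum 1) ?A"
    using assms by (simp add: terminating_def)
  hence "path_prob summable_on ?A" by (rule has_sum_imp_summable)
  hence "(\<lambda>\<pi>. norm (path_prob \<pi>)) summable_on ?A"
    using pos by (subst summable_on_cong[where g = path_prob]) auto
  hence abs: "Infinite_Set_Sum.abs_summable_on path_prob ?A"
    by (rule abs_summable_equivalent[THEN iffD1])
  have "(\<integral>\<^sup>+\<pi>. ennreal (path_prob \<pi>) * indicator ?A \<pi> \<partial>count_space UNIV) =
        (\<integral>\<^sup>+\<pi>. ennreal (path_prob \<pi>) \<partial>count_space ?A)"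
    by (simp add: nn_integral_count_space_indicator)
  also have "\<dots> = ennreal (infsetsum path_prob ?A)"
    using abs pos by (intro nn_integral_conv_infsetsum) auto
  also have "infsetsum path_prob ?A = 1"
    using abs hs by (simp add: infsetsum_infsum infsumI)
  finally show ?thesis by simp
qed

lemma pmf_term_space:
  assumes "terminating_rs C p S"
  shows "pmf (term_space C p S) (w, \<pi>) =
           (if \<pi> \<in> term_paths C (S w) then pmf p w * path_prob \<pi> else 0)"
proof -
  let ?f = "\<lambda>(w, \<pi>). if \<pi> \<in> term_paths C (S w) then pmf p w * path_prob \<pi> else (0 :: real)"
  have nn: "0 \<le> ?f x" for x
    using path_prob_pos by (cases x) (fastforce simp: term_paths_def intro: less_imp_le)
  have "(\<integral>\<^sup>+x. ennreal (?f x) \<partial>count_space UNIV) =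
        (\<integral>\<^sup>+w. \<integral>\<^sup>+\<pi>. ennreal (?f (w, \<pi>)) \<partial>count_space UNIV \<partial>count_space UNIV)"
    by (rule nn_integral_fst_count_space[symmetric])
  also have "\<dots> = (\<integral>\<^sup>+w. ennreal (pmf p w) \<partial>count_space UNIV)"
  proof (rule nn_integral_cong)
    fix w
    show "(\<integral>\<^sup>+\<pi>. ennreal (?f (w, \<pi>)) \<partial>count_space UNIV) = ennreal (pmf p w)"
    proof (cases "w \<in> set_pmf p")
      case True
      have "(\<integral>\<^sup>+\<pi>. ennreal (?f (w, \<pi>)) \<partial>count_space UNIV) =
            (\<integral>\<^sup>+\<pi>. ennreal (pmf p w) * (ennreal (path_prob \<pi>) * indicator (term_paths C (S w)) \<pi>)
               \<partial>count_space UNIV)"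
        by (intro nn_integral_cong) (auto simp: ennreal_mult' split: split_indicator)
      also have "\<dots> = ennreal (pmf p w)"
        using True assms
        by (subst nn_integral_cmult) (auto simp: path_prob_nn_integral terminating_rs_def)
      finally show ?thesis .
    next
      case False
      hence "pmf p w = 0" by (simp add: set_pmf_iff)
      thus ?thesis by (simp cong: if_cong)
    qed
  qed
  also have "\<dots> = 1"
    by (simp add: nn_integral_pmf_eq_1)
  finally show ?thesis
    unfolding term_space_def by (subst pmf_embed_pmf[OF nn]) auto
qed

lemma set_pmf_term_space:
  assumes "terminating_rs C p S"
  shows "set_pmf (term_space C p S) = (SIGMA w : set_pmf p. term_paths C (S w))"
proof -
  have "(w, \<pi>) \<in> set_pmf (term_space C p S) \<longleftrightarrow> w \<in> set_pmf p \<and> \<pi> \<in> term_paths C (S w)" for w \<pi>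
    using path_prob_pos[of "Running C (S w)" \<pi>]
    by (auto simp add: set_pmf_iff pmf_term_space[OF assms] term_paths_def)
  thus ?thesis by auto
qed

lemma final_eq:
  assumes "term_path c \<pi>" shows "snd (snd (last \<pi>)) = Terminal (final \<pi>)"
proof -
  have "\<pi> \<noteq> [] \<and> (\<exists>\<tau>. snd (snd (last \<pi>)) = Terminal \<tau>)"
    using assms by (induction rule: term_path.induct) auto
  thus ?thesis by (auto simp: final_def)
qed


text \<open>Semantic assertions. By invariance under isomorphisms of sample spaces, an assertion on
  all (countable) sample spaces is determined by its values on those whose carrier is a set of natural
  numbers; these values are what is recorded in \<open>'v sassn\<close>. The function \<open>assn_value\<close> extends
  an assertion to sample spaces over an arbitrary type by means of an enumeration of the carrier; the
  lemma \<open>assn_value_morphism\<close> below shows that the enumeration is irrelevant and that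
  the extension is invariant under all morphisms. The value \<^const>\<open>None\<close> stands for ``undefined''.\<close>

type_synonym 'v sassn = "nat pmf \<Rightarrow> (nat \<Rightarrow> 'v state) \<Rightarrow> bool option"

definition is_FV :: "'v sassn \<Rightarrow> 'v set \<Rightarrow> bool" where
  "is_FV \<Phi> V \<longleftrightarrow> finite V \<and> (\<forall>p S. \<Phi> p S \<noteq> None \<longleftrightarrow> total_rs V p S)"

definition FV :: "'v sassn \<Rightarrow> 'v set" where
  "FV \<Phi> = (THE V. is_FV \<Phi> V)"

definition semantic_assertion :: "'v sassn \<Rightarrow> bool" where
  "semantic_assertion \<Phi> \<longleftrightarrow>
     (\<forall>p S S'. (\<forall>w \<in> set_pmf p. S w \<subseteq>\<^sub>f S' w) \<and> \<Phi> p S \<noteq> None \<longrightarrow> \<Phi> p S = \<Phi> p S') \<and>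
     (\<exists>V. is_FV \<Phi> V) \<and>
     (\<forall>p' p q S. sample_morphism q p' p \<longrightarrow> \<Phi> p' (S \<circ> q) = \<Phi> p S)"

definition assn_value :: "'v sassn \<Rightarrow> 'w pmf \<Rightarrow> ('w \<Rightarrow> 'v state) \<Rightarrow> bool option" where
  "assn_value \<Phi> p S =
     \<Phi> (map_pmf (to_nat_on (set_pmf p)) p) (S \<circ> from_nat_into (set_pmf p))"

definition sat :: "'w pmf \<Rightarrow> ('w \<Rightarrow> 'v state) \<Rightarrow> 'v sassn \<Rightarrow> bool" where
  "sat p S \<Phi> \<longleftrightarrow> assn_value \<Phi> p S = Some True"

lemma is_FV_unique:
  fixes \<Phi> :: "'a sassn"
  assumes "is_FV \<Phi> V" "is_FV \<Phi> W" shows "V = W"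
proof -
  have "A \<subseteq> B" if "is_FV \<Phi> A" "is_FV \<Phi> B" for A B :: "'a set"
  proof -
    have "finite B"
      using \<open>is_FV \<Phi> B\<close> unfolding is_FV_def by (rule conjunct1)
    then obtain xs where xs: "set xs = B"
      by (rule finite_list[THEN exE])
    define \<sigma> :: "'a state" where "\<sigma> = fmap_of_list (map (\<lambda>x. (x, 0)) xs)"
    have dom: "fmdom' \<sigma> = B"
      by (simp add: \<sigma>_def xs fmdom'_alt_def fset_of_list.rep_eq image_image)
    have "\<Phi> (return_pmf 0) (\<lambda>_. \<sigma>) \<noteq> None"
    proof -
      have "total_rs B (return_pmf 0) (\<lambda>_ :: nat. \<sigma>)"
        by (simp add: total_rs_def total_state_def AE_measure_pmf_iff dom)
      thus ?thesis
        using \<open>is_FV \<Phi> B\<close> unfolding is_FV_def by blast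
    qed
    hence "total_rs A (return_pmf 0) (\<lambda>_ :: nat. \<sigma>)"
      using \<open>is_FV \<Phi> A\<close> unfolding is_FV_def by blast
    thus ?thesis
      by (simp add: total_rs_def total_state_def AE_measure_pmf_iff dom)
  qed
  from this[OF assms] this[OF assms(2,1)] show ?thesis by (rule subset_antisym)
qed

lemma is_FV_FV:
  assumes "semantic_assertion \<Phi>" shows "is_FV \<Phi> (FV \<Phi>)"
proof -
  obtain V where V: "is_FV \<Phi> V"
    using assms unfolding semantic_assertion_def by (elim conjE exE)
  show ?thesis
    unfolding FV_def using V by (rule theI) (rule is_FV_unique[OF _ V])
qed

lemma semantic_assertion_cong:
  assumes sem: "semantic_assertion \<Phi>" and eq: "\<And>w. w \<in> set_pmf p \<Longrightarrow> S w = S' w"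
  shows "\<Phi> p S = \<Phi> p S'"
proof -
  have "\<Phi> p S \<noteq> None \<Longrightarrow> \<Phi> p S = \<Phi> p S'" "\<Phi> p S' \<noteq> None \<Longrightarrow> \<Phi> p S' = \<Phi> p S"
    using sem eq by (simp_all add: semantic_assertion_def fmsubset_alt_def fmpred_iff)
  thus ?thesis by (cases "\<Phi> p S") (auto, metis not_None_eq)
qed

lemma assn_value_morphism:
  fixes p' :: "'w pmf" and p :: "'u pmf"
  assumes sem: "semantic_assertion \<Phi>" and q: "sample_morphism q p' p"
  shows "assn_value \<Phi> p' (S \<circ> q) = assn_value \<Phi> p S"
proof -
  let ?e' = "to_nat_on (set_pmf p')" and ?d' = "from_nat_into (set_pmf p')"
  let ?e = "to_nat_on (set_pmf p)" and ?d = "from_nat_into (set_pmf p)"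
  let ?r = "?e \<circ> q \<circ> ?d'"
  have p: "p = map_pmf q p'" using q by (simp add: sample_morphism_def)
  have "map_pmf ?r (map_pmf ?e' p') = map_pmf (?e \<circ> q) p'"
    unfolding pmf.map_comp by (rule map_pmf_cong) (auto simp: countable_set_pmf)
  also have "\<dots> = map_pmf ?e p" by (simp add: p pmf.map_comp)
  finally have "sample_morphism ?r (map_pmf ?e' p') (map_pmf ?e p)"
    by (simp add: sample_morphism_def)
  hence "\<Phi> (map_pmf ?e p) (S \<circ> ?d) = \<Phi> (map_pmf ?e' p') (S \<circ> ?d \<circ> ?r)"
    using sem by (simp add: semantic_assertion_def)
  also have "\<dots> = \<Phi> (map_pmf ?e' p') (S \<circ> q \<circ> ?d')"
    using sem by (rule semantic_assertion_cong) (auto simp: p countable_set_pmf)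
  finally show ?thesis by (simp add: assn_value_def)
qed

lemma assn_value_nat:
  assumes "semantic_assertion \<Phi>" shows "assn_value \<Phi> p S = \<Phi> p S"
proof -
  let ?e = "to_nat_on (set_pmf p)" and ?d = "from_nat_into (set_pmf p)"
  have "\<Phi> (map_pmf ?e p) (S \<circ> ?d) = \<Phi> p (S \<circ> ?d \<circ> ?e)"
    using assms by (simp add: semantic_assertion_def sample_morphism_def)
  also have "\<dots> = \<Phi> p S"
    using assms by (rule semantic_assertion_cong) (auto simp: countable_set_pmf)
  finally show ?thesis by (simp add: assn_value_def)
qed


text \<open>Up to isomorphism, sample spaces over \<^typ>\<open>nat\<close> are all sample spaces.\<close>

definition partially_correct :: "'v sassn \<Rightarrow> 'v com \<Rightarrow> 'v sassn \<Rightarrow> bool" where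
  "partially_correct \<Phi> C \<Psi> \<longleftrightarrow>
     (\<forall>(p :: nat pmf) S. sat p S \<Phi> \<longrightarrow>
        fault_free_rs C p S \<and>
        (terminating_rs C p S \<longrightarrow> sat (term_space C p S) term_rs \<Psi>))"

end

theory Submission
  imports Defs
begin

text \<open>Restricting the initial random state to \<open>FV \<Phi>\<close> preserves \<open>\<Phi>\<close>, so \<open>C\<close> does not fault on the
  restricted states. Hence a run from \<open>\<sigma>\<close> and a run from its restriction can be matched transition by
  transition with the same labels, so that termination passes to the restriction and \<open>\<Psi>\<close> holds of
  its termination random state. In particular that random state is total on \<open>FV \<Psi>\<close>, so matching runs
  end in states that agree on \<open>FV \<Psi>\<close>. The law of the final values on \<open>FV \<Psi>\<close> given the initial
  state is therefore a function of the restricted initial state only.\<close>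

section \<open>Monotonicity of the operational semantics\<close>

lemma fmsubset_restrict_eq:
  assumes "\<sigma> \<subseteq>\<^sub>f \<sigma>'" "V \<subseteq> fmdom' \<sigma>"
  shows "fmrestrict_set V \<sigma> = fmrestrict_set V \<sigma>'"
proof (rule fmap_ext)
  fix x
  show "fmlookup (fmrestrict_set V \<sigma>) x = fmlookup (fmrestrict_set V \<sigma>') x"
    using assms by (cases "fmlookup \<sigma> x")
      (auto simp: fmsubset.rep_eq map_le_def fmlookup_dom'_iff subset_iff dom_def)
qed

lemma fmrestrict_set_fmsubset: "fmrestrict_set V \<sigma> \<subseteq>\<^sub>f \<sigma>"
  by (auto simp: fmsubset.rep_eq map_le_def dom_def)

lemma fmsubset_upd: "\<sigma> \<subseteq>\<^sub>f \<sigma>' \<Longrightarrow> fmupd X n \<sigma> \<subseteq>\<^sub>f fmupd X n \<sigma>'"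
  by (auto simp: fmsubset.rep_eq map_le_def dom_def)

text \<open>The variables of \<open>E\<close> already lie in the domain of \<open>\<sigma>\<close>,
  so both states have the same restriction to them.\<close>

lemma expr_eval_mono:
  assumes "expr_eval E \<sigma> = Some v" "\<sigma> \<subseteq>\<^sub>f \<sigma>'"
  shows "expr_eval E \<sigma>' = Some v"
proof -
  obtain V f where E: "Rep_expr E = (V, f)" by (cases "Rep_expr E")
  have dom: "\<forall>\<sigma>. f \<sigma> \<noteq> None \<longleftrightarrow> V \<subseteq> fmdom' \<sigma>"
    and dep: "\<forall>\<sigma> \<sigma>'. fmrestrict_set V \<sigma> = fmrestrict_set V \<sigma>' \<longrightarrow> f \<sigma> = f \<sigma>'"
    using Rep_expr[of E] unfolding E mem_Collect_eq prod.case by - (elim conjE, assumption)+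
  have f: "f \<sigma> = Some v" using assms(1) by (simp add: expr_eval_def E)
  hence "V \<subseteq> fmdom' \<sigma>" using dom[THEN spec, of \<sigma>] by simp
  with assms(2) have "fmrestrict_set V \<sigma> = fmrestrict_set V \<sigma>'" by (rule fmsubset_restrict_eq)
  with dep have "f \<sigma> = f \<sigma>'" by blast
  with f show ?thesis by (simp add: expr_eval_def E)
qed

text \<open>\<open>Fault\<close> is related to nothing: an undefined expression may become defined
  in a larger state. A related pair thus also certifies that neither side has faulted.\<close>

inductive config_le :: "'v config \<Rightarrow> 'v config \<Rightarrow> bool" where
  "\<sigma> \<subseteq>\<^sub>f \<sigma>' \<Longrightarrow> config_le (Running C \<sigma>) (Running C \<sigma>')"
| "\<sigma> \<subseteq>\<^sub>f \<sigma>' \<Longrightarrow> config_le (Terminal \<sigma>) (Terminal \<sigma>')"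

inductive_cases config_le_RunningE: "config_le (Running C \<sigma>) d"
inductive_cases config_le_TerminalE: "config_le (Terminal \<sigma>) d"
inductive_cases config_le_RunningE': "config_le c (Running C \<sigma>)"
inductive_cases config_le_TerminalE': "config_le c (Terminal \<sigma>)"
inductive_cases config_le_FaultE': "config_le c Fault"

lemmas config_leE = config_le_RunningE config_le_TerminalE
  config_le_RunningE' config_le_TerminalE' config_le_FaultE'

section \<open>Single steps: determinism and simulation in both directions\<close>

inductive_cases step_AssignE: "step (Running (Assign X E) \<sigma>) L c"
inductive_cases step_SampleE: "step (Running (Sample X D) \<sigma>) L c"
inductive_cases step_SkipE: "step (Running Skip \<sigma>) L c"
inductive_cases step_SeqE: "step (Running (Seq C1 C2) \<sigma>) L c"
inductive_cases step_CondE: "step (Running (Cond B C1 C2) \<sigma>) L c"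
inductive_cases step_WhileE: "step (Running (While B C) \<sigma>) L c"
inductive_cases step_TerminalE: "step (Terminal \<sigma>) L c"
inductive_cases step_FaultE: "step Fault L c"

text \<open>The label carries the sampled value, so fixing it leaves no randomness. This is what
  lets label lists identify paths.\<close>

lemma step_deterministic: "step c L c1 \<Longrightarrow> step c L c2 \<Longrightarrow> c1 = c2"
proof (induction arbitrary: c2 rule: step.induct)
  case SeqRunning
  from SeqRunning.prems show ?case by (rule step_SeqE) (use SeqRunning.IH in fastforce)+
next
  case SeqTerminal
  from SeqTerminal.prems show ?case by (rule step_SeqE) (use SeqTerminal.IH in fastforce)+
next
  case SeqFault
  from SeqFault.prems show ?case by (rule step_SeqE) (use SeqFault.IH in fastforce)+
qed (auto elim: step_AssignE step_SampleE step_SkipE step_CondE step_WhileE)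

lemma step_Fault_label: "step c L Fault \<Longrightarrow> L = None"
  by (cases rule: step.cases) auto

text \<open>Forward simulation: an expression defined in the smaller state keeps its value in the
  larger one, so the same rule fires with the same label.\<close>

lemma step_mono:
  assumes "step c L c'" "config_le c d" "c' \<noteq> Fault"
  shows "\<exists>d'. step d L d' \<and> config_le c' d'"
  using assms
proof (induction arbitrary: d rule: step.induct)
  case (SeqRunning C1 \<sigma> L C1' \<sigma>' C2)
  from SeqRunning.prems(1) obtain \<rho> where "d = Running (Seq C1 C2) \<rho>" "\<sigma> \<subseteq>\<^sub>f \<rho>"
    by (auto elim: config_leE)
  with SeqRunning.IH[of "Running C1 \<rho>"] show ?case
    by (fastforce elim!: config_leE intro: config_le.intros step.intros)
next
  case (SeqTerminal C1 \<sigma> L \<sigma>' C2)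
  from SeqTerminal.prems(1) obtain \<rho> where "d = Running (Seq C1 C2) \<rho>" "\<sigma> \<subseteq>\<^sub>f \<rho>"
    by (auto elim: config_leE)
  with SeqTerminal.IH[of "Running C1 \<rho>"] show ?case
    by (fastforce elim!: config_leE intro: config_le.intros step.intros)
qed (elim config_le_RunningE; blast dest: expr_eval_mono intro: config_le.intros fmsubset_upd
      step.Assign step.Sample step.Skip step.IfTrue step.IfFalse step.WhileFalse step.WhileTrue)+

lemma expr_eval_Some_lower:
  assumes "expr_eval E \<sigma>' = Some v" "\<sigma> \<subseteq>\<^sub>f \<sigma>'" "expr_eval E \<sigma> \<noteq> None"
  shows "expr_eval E \<sigma> = Some v"
  using assms expr_eval_mono[OF _ assms(2)] by fastforce

lemma expr_eval_None_lower:
  assumes "expr_eval E \<sigma>' = None" "\<sigma> \<subseteq>\<^sub>f \<sigma>'"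
  shows "expr_eval E \<sigma> = None"
  using assms(1) expr_eval_mono[OF _ assms(2), of E] by (cases "expr_eval E \<sigma>") auto

text \<open>Backward simulation: as \<open>c\<close> cannot fault, any expression it evaluates is
  defined, and \<open>expr_eval_mono\<close> forces the value seen by \<open>d\<close>. A faulting
  step of \<open>d\<close> is contradictory, since what is undefined in the larger state is
  undefined in the smaller one.\<close>

lemma step_reflect:
  assumes "step d L d'" "config_le c d" "\<And>L. \<not> step c L Fault"
  shows "\<exists>c'. step c L c' \<and> config_le c' d'"
  using assms
proof (induction arbitrary: c rule: step.induct)
  case (SeqRunning C1 \<rho> L C1' \<rho>' C2)
  from SeqRunning.prems(1) obtain \<sigma> where c: "c = Running (Seq C1 C2) \<sigma>" "\<sigma> \<subseteq>\<^sub>f \<rho>"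
    by (auto elim: config_leE)
  \<comment> \<open>\<open>SeqFault\<close> propagates only unlabelled faults;
    \<open>step_Fault_label\<close> shows that there are no others.\<close>
  have "\<not> step (Running C1 \<sigma>) L Fault" for L
    using SeqRunning.prems(2) c(1) step_Fault_label step.SeqFault by metis
  with c SeqRunning.IH[of "Running C1 \<sigma>"] show ?case
    by (fastforce elim!: config_leE intro: config_le.intros step.intros)
next
  case (SeqTerminal C1 \<rho> L \<rho>' C2)
  from SeqTerminal.prems(1) obtain \<sigma> where c: "c = Running (Seq C1 C2) \<sigma>" "\<sigma> \<subseteq>\<^sub>f \<rho>"
    by (auto elim: config_leE)
  have "\<not> step (Running C1 \<sigma>) L Fault" for L
    using SeqTerminal.prems(2) c(1) step_Fault_label step.SeqFault by metis
  with c SeqTerminal.IH[of "Running C1 \<sigma>"] show ?case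
    by (fastforce elim!: config_leE intro: config_le.intros step.intros)
next
  case (SeqFault C1 \<rho> C2)
  from SeqFault.prems(1) obtain \<sigma> where c: "c = Running (Seq C1 C2) \<sigma>" "\<sigma> \<subseteq>\<^sub>f \<rho>"
    by (auto elim: config_leE)
  have "\<not> step (Running C1 \<sigma>) L Fault" for L
    using SeqFault.prems(2) c(1) step_Fault_label step.SeqFault by metis
  \<comment> \<open>The induction hypothesis would put some configuration below
    \<open>Fault\<close>, which \<open>config_le\<close> rules out.\<close>
  with c SeqFault.IH[of "Running C1 \<sigma>"] show ?case
    by (fastforce elim!: config_leE intro: config_le.intros)
next
  case (Assign E \<rho> n X)
  from Assign.prems(1) obtain \<sigma> where c: "c = Running (Assign X E) \<sigma>" "\<sigma> \<subseteq>\<^sub>f \<rho>"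
    by (auto elim: config_leE)
  with Assign.prems(2) have "expr_eval E \<sigma> \<noteq> None" using step.AssignFault by metis
  with c Assign.hyps have "expr_eval E \<sigma> = Some n" by (blast intro: expr_eval_Some_lower)
  with c Assign.hyps show ?case by (blast intro: config_le.intros step.intros fmsubset_upd)
next
  case (AssignFault E \<rho> X)
  from AssignFault.prems(1) obtain \<sigma> where c: "c = Running (Assign X E) \<sigma>" "\<sigma> \<subseteq>\<^sub>f \<rho>"
    by (auto elim: config_leE)
  with AssignFault.hyps have "expr_eval E \<sigma> = None" by (blast intro: expr_eval_None_lower)
  with c AssignFault.prems(2) show ?case by (blast intro: step.intros)
next
  case (Sample D \<rho> d n X)
  from Sample.prems(1) obtain \<sigma> where c: "c = Running (Sample X D) \<sigma>" "\<sigma> \<subseteq>\<^sub>f \<rho>"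
    by (auto elim: config_leE)
  with Sample.prems(2) have "expr_eval D \<sigma> \<noteq> None" using step.SampleFault by metis
  with c Sample.hyps have "expr_eval D \<sigma> = Some d" by (blast intro: expr_eval_Some_lower)
  with c Sample.hyps show ?case by (blast intro: config_le.intros step.intros fmsubset_upd)
next
  case (SampleFault D \<rho> X)
  from SampleFault.prems(1) obtain \<sigma> where c: "c = Running (Sample X D) \<sigma>" "\<sigma> \<subseteq>\<^sub>f \<rho>"
    by (auto elim: config_leE)
  with SampleFault.hyps have "expr_eval D \<sigma> = None" by (blast intro: expr_eval_None_lower)
  with c SampleFault.prems(2) show ?case by (blast intro: step.intros)
next
  case (IfTrue B \<rho> C1 C2)
  from IfTrue.prems(1) obtain \<sigma> where c: "c = Running (Cond B C1 C2) \<sigma>" "\<sigma> \<subseteq>\<^sub>f \<rho>"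
    by (auto elim: config_leE)
  with IfTrue.prems(2) have "expr_eval B \<sigma> \<noteq> None" using step.IfFault by metis
  with c IfTrue.hyps have "expr_eval B \<sigma> = Some True" by (blast intro: expr_eval_Some_lower)
  with c IfTrue.hyps show ?case by (blast intro: config_le.intros step.intros fmsubset_upd)
next
  case (IfFalse B \<rho> C1 C2)
  from IfFalse.prems(1) obtain \<sigma> where c: "c = Running (Cond B C1 C2) \<sigma>" "\<sigma> \<subseteq>\<^sub>f \<rho>"
    by (auto elim: config_leE)
  with IfFalse.prems(2) have "expr_eval B \<sigma> \<noteq> None" using step.IfFault by metis
  with c IfFalse.hyps have "expr_eval B \<sigma> = Some False" by (blast intro: expr_eval_Some_lower)
  with c IfFalse.hyps show ?case by (blast intro: config_le.intros step.intros fmsubset_upd)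
next
  case (IfFault B \<rho> C1 C2)
  from IfFault.prems(1) obtain \<sigma> where c: "c = Running (Cond B C1 C2) \<sigma>" "\<sigma> \<subseteq>\<^sub>f \<rho>"
    by (auto elim: config_leE)
  with IfFault.hyps have "expr_eval B \<sigma> = None" by (blast intro: expr_eval_None_lower)
  with c IfFault.prems(2) show ?case by (blast intro: step.intros)
next
  case (WhileFalse B \<rho> C)
  from WhileFalse.prems(1) obtain \<sigma> where c: "c = Running (While B C) \<sigma>" "\<sigma> \<subseteq>\<^sub>f \<rho>"
    by (auto elim: config_leE)
  with WhileFalse.prems(2) have "expr_eval B \<sigma> \<noteq> None" using step.WhileFault by metis
  with c WhileFalse.hyps have "expr_eval B \<sigma> = Some False" by (blast intro: expr_eval_Some_lower)
  with c WhileFalse.hyps show ?case by (blast intro: config_le.intros step.intros fmsubset_upd)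
next
  case (WhileTrue B \<rho> C)
  from WhileTrue.prems(1) obtain \<sigma> where c: "c = Running (While B C) \<sigma>" "\<sigma> \<subseteq>\<^sub>f \<rho>"
    by (auto elim: config_leE)
  with WhileTrue.prems(2) have "expr_eval B \<sigma> \<noteq> None" using step.WhileFault by metis
  with c WhileTrue.hyps have "expr_eval B \<sigma> = Some True" by (blast intro: expr_eval_Some_lower)
  with c WhileTrue.hyps show ?case by (blast intro: config_le.intros step.intros fmsubset_upd)
next
  case (WhileFault B \<rho> C)
  from WhileFault.prems(1) obtain \<sigma> where c: "c = Running (While B C) \<sigma>" "\<sigma> \<subseteq>\<^sub>f \<rho>"
    by (auto elim: config_leE)
  with WhileFault.hyps have "expr_eval B \<sigma> = None" by (blast intro: expr_eval_None_lower)
  with c WhileFault.prems(2) show ?case by (blast intro: step.intros)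
qed (elim config_le_RunningE', blast intro: config_le.intros step.Skip)


section \<open>Terminal paths are determined by their labels\<close>

text \<open>A label list mentions no state, so runs from different initial states can be compared
  through it.\<close>

definition labels :: "'v cpath \<Rightarrow> label list" where
  "labels \<pi> = map (\<lambda>(c, L, c'). L) \<pi>"

lemma labels_simps [simp]: "labels [] = []" "labels ((c, L, c') # \<pi>) = L # labels \<pi>"
  by (simp_all add: labels_def)

lemma path_prob_labels: "path_prob \<pi> = prod_list (map label_prob (labels \<pi>))"
  unfolding path_prob_def labels_def map_map
  by (intro arg_cong[where f = prod_list] map_cong) auto

lemma final_singleton [simp]: "final [(c, L, Terminal \<tau>)] = \<tau>"
  by (simp add: final_def)

lemma final_Cons [simp]: "\<pi> \<noteq> [] \<Longrightarrow> final (t # \<pi>) = final \<pi>"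
  by (simp add: final_def)

lemma term_path_not_Nil: "term_path c \<pi> \<Longrightarrow> \<pi> \<noteq> []"
  by (cases rule: term_path.cases) auto

lemma term_path_Running: "term_path c \<pi> \<Longrightarrow> \<exists>C \<sigma>. c = Running C \<sigma>"
  by (cases c; cases rule: term_path.cases) (auto elim: step_TerminalE step_FaultE)

text \<open>Equal labels force equal successors by \<open>step_deterministic\<close>, and equal
  lengths make both paths stop together.\<close>

lemma term_path_labels_inj:
  assumes "term_path c \<pi>" "term_path c \<pi>'" "labels \<pi> = labels \<pi>'"
  shows "\<pi> = \<pi>'"
  using assms
proof (induction arbitrary: \<pi>' rule: term_path.induct)
  case (last c L \<tau>)
  note hyps = last.hyps and prems = last.prems
  from prems(1) show ?case
  proof (cases rule: term_path.cases)
    case (last L' \<tau>')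
    with hyps prems(2) show ?thesis by (auto dest: step_deterministic)
  next
    case (step L' c' \<pi>1)
    with prems(2) term_path_not_Nil[of c' \<pi>1] show ?thesis by (auto simp: labels_def)
  qed
next
  case (step c L c' \<pi>)
  note hyps = step.hyps and prems = step.prems and IH = step.IH
  from prems(1) show ?case
  proof (cases rule: term_path.cases)
    case (last L' \<tau>')
    with prems(2) term_path_not_Nil[OF hyps(2)] show ?thesis by (auto simp: labels_def)
  next
    case (step L' c1 \<pi>1)
    with prems(2) have "L' = L" "labels \<pi> = labels \<pi>1" by auto
    moreover from this step hyps have "c1 = c'" by (auto dest: step_deterministic)
    ultimately show ?thesis using step IH[of \<pi>1] by auto
  qed
qed

text \<open>Iterates \<open>step_mono\<close>; the comparison of final states is what later matches
  the outcomes of the two runs.\<close>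

lemma term_path_mono:
  assumes "term_path c \<pi>" "config_le c d"
  shows "\<exists>\<pi>'. term_path d \<pi>' \<and> labels \<pi>' = labels \<pi> \<and> final \<pi> \<subseteq>\<^sub>f final \<pi>'"
  using assms
proof (induction arbitrary: d rule: term_path.induct)
  case (last c L \<tau>)
  with step_mono obtain d' where "step d L d'" "config_le (Terminal \<tau>) d'" by blast
  then obtain \<tau>' where "step d L (Terminal \<tau>')" "\<tau> \<subseteq>\<^sub>f \<tau>'" by (auto elim: config_leE)
  thus ?case by (intro exI[of _ "[(d, L, Terminal \<tau>')]"]) (auto intro: term_path.intros)
next
  case (step c L c' \<pi>)
  have "c' \<noteq> Fault" using term_path_Running[OF step.hyps(2)] by auto
  with step step_mono obtain d' where d': "step d L d'" "config_le c' d'" by blast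
  with step.IH obtain \<pi>' where
    "term_path d' \<pi>'" "labels \<pi>' = labels \<pi>" "final \<pi> \<subseteq>\<^sub>f final \<pi>'" by blast
  with d' step.hyps show ?case
    by (intro exI[of _ "(d, L, d') # \<pi>'"]) (auto simp: term_path_not_Nil intro: term_path.intros)
qed

text \<open>Iterates \<open>step_reflect\<close>. The absence of faults is phrased as unreachability
  so that successors inherit it.\<close>

lemma term_path_reflect:
  assumes "term_path d \<pi>" "config_le c d" "\<not> (\<lambda>c c'. \<exists>L. step c L c')\<^sup>*\<^sup>* c Fault"
  shows "\<exists>\<pi>'. term_path c \<pi>' \<and> labels \<pi>' = labels \<pi>"
  using assms
proof (induction arbitrary: c rule: term_path.induct)
  case (last d L \<tau>)
  have "\<not> step c L Fault" for L using last.prems(2) by blast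
  with last step_reflect obtain c' where "step c L c'" "config_le c' (Terminal \<tau>)" by blast
  then obtain \<tau>' where "step c L (Terminal \<tau>')" by (auto elim: config_leE)
  thus ?case by (intro exI[of _ "[(c, L, Terminal \<tau>')]"]) (auto intro: term_path.intros)
next
  case (step d L d' \<pi>)
  have "\<not> step c L Fault" for L using step.prems(2) by blast
  with step step_reflect obtain c' where c': "step c L c'" "config_le c' d'" by blast
  have "\<not> (\<lambda>c c'. \<exists>L. step c L c')\<^sup>*\<^sup>* c' Fault"
    using step.prems(2) converse_rtranclp_into_rtranclp[of "\<lambda>c c'. \<exists>L. step c L c'" c c' Fault] c'(1)
    by blast
  with c' step.IH obtain \<pi>' where "term_path c' \<pi>'" "labels \<pi>' = labels \<pi>" by blast
  with c' show ?case
    by (intro exI[of _ "(c, L, c') # \<pi>'"]) (auto intro: term_path.intros)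
qed

section \<open>Terminal paths and termination from comparable states\<close>

lemma inj_on_labels: "inj_on labels (term_paths C \<sigma>)"
  by (auto simp: inj_on_def term_paths_def intro: term_path_labels_inj)

text \<open>The two inclusions are the two simulations.\<close>

lemma labels_term_paths_eq:
  assumes "\<sigma> \<subseteq>\<^sub>f \<sigma>'" "fault_free C \<sigma>"
  shows "labels ` term_paths C \<sigma>' = labels ` term_paths C \<sigma>"
proof -
  have le: "config_le (Running C \<sigma>) (Running C \<sigma>')" using assms(1) by (rule config_le.intros)
  show ?thesis
  proof (intro subset_antisym subsetI)
    fix ls assume "ls \<in> labels ` term_paths C \<sigma>'"
    then obtain \<pi> where "term_path (Running C \<sigma>') \<pi>" "ls = labels \<pi>"
      by (auto simp: term_paths_def)
    with term_path_reflect[OF _ le, of \<pi>] assms(2) show "ls \<in> labels ` term_paths C \<sigma>"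
      by (auto simp: term_paths_def fault_free_def image_iff)
  next
    fix ls assume "ls \<in> labels ` term_paths C \<sigma>"
    then obtain \<pi> where "term_path (Running C \<sigma>) \<pi>" "ls = labels \<pi>"
      by (auto simp: term_paths_def)
    with term_path_mono[OF _ le, of \<pi>] show "ls \<in> labels ` term_paths C \<sigma>'"
      by (auto simp: term_paths_def image_iff)
  qed
qed

text \<open>\<open>term_path_mono\<close> gives a path from \<open>\<sigma>'\<close> with these
  labels and a larger final state; injectivity of labels identifies it with
  \<open>\<pi>'\<close>.\<close>

lemma final_fmsubset:
  assumes "\<sigma> \<subseteq>\<^sub>f \<sigma>'" "\<pi> \<in> term_paths C \<sigma>" "\<pi>' \<in> term_paths C \<sigma>'" "labels \<pi> = labels \<pi>'"
  shows "final \<pi> \<subseteq>\<^sub>f final \<pi>'"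
proof -
  obtain \<pi>1 where "term_path (Running C \<sigma>') \<pi>1" "labels \<pi>1 = labels \<pi>" "final \<pi> \<subseteq>\<^sub>f final \<pi>1"
    using term_path_mono[OF _ config_le.intros(1)[OF assms(1)], of C \<pi>] assms(2)
    by (auto simp: term_paths_def)
  with assms(3,4) show ?thesis
    using term_path_labels_inj[of "Running C \<sigma>'" \<pi>1 \<pi>'] by (auto simp: term_paths_def)
qed

text \<open>Path probabilities depend on labels only, so the total mass can be reindexed as a sum
  over label lists, with one index set for both states.\<close>

lemma terminating_lower:
  assumes "\<sigma> \<subseteq>\<^sub>f \<sigma>'" "fault_free C \<sigma>" "terminating C \<sigma>'"
  shows "terminating C \<sigma>"
proof -
  let ?g = "\<lambda>ls. prod_list (map label_prob ls)"
  have "terminating C \<rho> \<longleftrightarrow> (?g has_sum 1) (labels ` term_paths C \<rho>)" for \<rho>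
    unfolding has_sum_reindex[OF inj_on_labels] terminating_def
    by (simp add: comp_def path_prob_labels[abs_def])
  with assms(3) show ?thesis by (simp add: labels_term_paths_eq[OF assms(1,2)])
qed


section \<open>The law of the terminal path\<close>

text \<open>Taken from the termination space over a one-point sample space, so that
  \<open>pmf_term_space\<close> supplies the normalisation for terminating configurations.\<close>

definition path_pmf :: "'v com \<Rightarrow> 'v state \<Rightarrow> 'v cpath pmf" where
  "path_pmf C \<sigma> = map_pmf snd (term_space C (return_pmf ()) (\<lambda>_. \<sigma>))"

lemma pmf_path_pmf:
  assumes "terminating C \<sigma>"
  shows "pmf (path_pmf C \<sigma>) \<pi> = (if \<pi> \<in> term_paths C \<sigma> then path_prob \<pi> else 0)"
proof -
  \<comment> \<open>Over a one-point space the projection merges no points, so point masses carry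
    over.\<close>
  have "inj (snd :: unit \<times> 'a cpath \<Rightarrow> _)" by (auto intro: injI)
  hence "pmf (path_pmf C \<sigma>) (snd ((), \<pi>)) = pmf (term_space C (return_pmf ()) (\<lambda>_. \<sigma>)) ((), \<pi>)"
    unfolding path_pmf_def by (rule pmf_map_inj')
  thus ?thesis
    using assms by (simp add: pmf_term_space terminating_rs_def)
qed

lemma set_path_pmf: "terminating C \<sigma> \<Longrightarrow> set_pmf (path_pmf C \<sigma>) = term_paths C \<sigma>"
  using path_prob_pos[of "Running C \<sigma>"]
  by (auto simp: set_pmf_iff pmf_path_pmf term_paths_def order_less_le split: if_splits)

lemma pmf_bind_Pair:
  "pmf (bind_pmf p (\<lambda>w. map_pmf (Pair w) (k w))) (w, y) = pmf p w * pmf (k w) y"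
proof -
  \<comment> \<open>The first coordinate is always \<open>v\<close>, so only the atom
    \<open>v = w\<close> survives in the integral.\<close>
  have row: "pmf (map_pmf (Pair v) (k v)) (w, y) = indicator {w} v * pmf (k w) y" for v
  proof (cases "v = w")
    case True
    have "pmf (map_pmf (Pair v) (k v)) (Pair v y) = pmf (k v) y"
      by (rule pmf_map_inj') (simp add: inj_on_def)
    with True show ?thesis by simp
  next
    case False
    hence "(w, y) \<notin> set_pmf (map_pmf (Pair v) (k v))" by auto
    with False show ?thesis unfolding pmf_eq_0_set_pmf[symmetric] by simp
  qed
  show ?thesis unfolding pmf_bind row by (simp add: measure_pmf_single)
qed

text \<open>Exhibits the termination space as a draw from \<open>p\<close> followed by a kernel that
  sees the sample only through its state.\<close>

lemma term_space_bind:
  assumes "terminating_rs C p S"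
  shows "term_space C p S = bind_pmf p (\<lambda>w. map_pmf (Pair w) (path_pmf C (S w)))"
proof (rule pmf_eqI, clarify)
  fix w \<pi>
  show "pmf (term_space C p S) (w, \<pi>) =
      pmf (bind_pmf p (\<lambda>w. map_pmf (Pair w) (path_pmf C (S w)))) (w, \<pi>)"
  proof (cases "w \<in> set_pmf p")
    case True
    with assms have "terminating C (S w)" by (simp add: terminating_rs_def)
    thus ?thesis by (simp add: pmf_bind_Pair pmf_term_space[OF assms] pmf_path_pmf)
  next
    case False
    \<comment> \<open>Termination is known only on the carrier; elsewhere the factor
      \<open>pmf p w\<close> makes both sides vanish.\<close>
    hence "pmf p w = 0" by (simp add: set_pmf_iff)
    thus ?thesis by (simp add: pmf_bind_Pair pmf_term_space[OF assms])
  qed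
qed

text \<open>By injectivity each label list inherits the probability of its only path, a product read
  off the labels, and both states realise the same lists.\<close>

lemma map_labels_path_pmf:
  assumes "\<sigma> \<subseteq>\<^sub>f \<sigma>'" "fault_free C \<sigma>" "terminating C \<sigma>'"
  shows "map_pmf labels (path_pmf C \<sigma>') = map_pmf labels (path_pmf C \<sigma>)"
proof -
  have pmf: "pmf (map_pmf labels (path_pmf C \<rho>)) ls =
      (if ls \<in> labels ` term_paths C \<rho> then prod_list (map label_prob ls) else 0)"
    if "terminating C \<rho>" for \<rho> :: "'a state" and ls
  proof (cases "ls \<in> labels ` term_paths C \<rho>")
    case True
    then obtain \<pi> where "\<pi> \<in> term_paths C \<rho>" "ls = labels \<pi>" by auto
    with inj_on_labels[of C \<rho>] that show ?thesis
      by (simp add: pmf_map_inj set_path_pmf pmf_path_pmf path_prob_labels)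
  next
    case False
    with that show ?thesis by (simp add: pmf_eq_0_set_pmf set_path_pmf)
  qed
  show ?thesis
    using assms terminating_lower[OF assms]
    by (intro pmf_eqI) (simp add: pmf labels_term_paths_eq[OF assms(1,2)])
qed

text \<open>Totality of the outcomes from \<open>\<sigma>\<close> turns inclusion of matching final
  states into equality on \<open>W\<close>. The outcome on \<open>W\<close> is then one function of
  the labels for both states, and the label laws agree.\<close>

lemma map_final_path_pmf:
  assumes "\<sigma> \<subseteq>\<^sub>f \<sigma>'" "fault_free C \<sigma>" "terminating C \<sigma>'"
    and total: "\<And>\<pi>. \<pi> \<in> term_paths C \<sigma> \<Longrightarrow> W \<subseteq> fmdom' (final \<pi>)"
  shows "map_pmf (\<lambda>\<pi>. fmrestrict_set W (final \<pi>)) (path_pmf C \<sigma>') =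
         map_pmf (\<lambda>\<pi>. fmrestrict_set W (final \<pi>)) (path_pmf C \<sigma>)"
proof -
  let ?F = "\<lambda>\<pi>. fmrestrict_set W (final \<pi>)"
  \<comment> \<open>\<open>h\<close> replays a label list from the smaller state. It matters only on
    lists realised there, where \<open>the_inv_into\<close> is a genuine inverse.\<close>
  define h where "h = (\<lambda>ls. ?F (the_inv_into (term_paths C \<sigma>) labels ls))"
  have lower: "?F \<pi> = h (labels \<pi>)" if "\<pi> \<in> term_paths C \<sigma>" for \<pi>
    using that by (simp add: h_def the_inv_into_f_f inj_on_labels)
  have upper: "?F \<pi>' = h (labels \<pi>')" if \<pi>': "\<pi>' \<in> term_paths C \<sigma>'" for \<pi>'
  proof -
    obtain \<pi> where \<pi>: "\<pi> \<in> term_paths C \<sigma>" "labels \<pi> = labels \<pi>'"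
      using \<pi>' labels_term_paths_eq[OF assms(1,2)] by (metis imageE imageI)
    have "?F \<pi> = ?F \<pi>'"
      using final_fmsubset[OF assms(1) \<pi>(1) \<pi>' \<pi>(2)] total[OF \<pi>(1)]
      by (rule fmsubset_restrict_eq)
    with lower \<pi> show ?thesis by simp
  qed
  have "map_pmf ?F (path_pmf C \<sigma>') = map_pmf h (map_pmf labels (path_pmf C \<sigma>'))"
    unfolding pmf.map_comp using assms(3) by (intro map_pmf_cong) (auto simp: set_path_pmf upper)
  also have "\<dots> = map_pmf h (map_pmf labels (path_pmf C \<sigma>))"
    by (simp only: map_labels_path_pmf[OF assms(1-3)])
  also have "\<dots> = map_pmf ?F (path_pmf C \<sigma>)"
    unfolding pmf.map_comp using terminating_lower[OF assms(1-3)]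
    by (intro map_pmf_cong) (auto simp: set_path_pmf lower)
  finally show ?thesis .
qed


section \<open>Conditional independence from a kernel\<close>

text \<open>An event about the first coordinate only reweights the draw from \<open>p\<close>; the
  kernel is left alone.\<close>

lemma cond_pmf_bind_Pair:
  assumes "set_pmf p \<inter> A \<noteq> {}"
  shows "cond_pmf (bind_pmf p (\<lambda>w. map_pmf (Pair w) (k w))) (fst -` A) =
         bind_pmf (cond_pmf p A) (\<lambda>w. map_pmf (Pair w) (k w))"
    (is "cond_pmf ?P _ = bind_pmf _ ?k")
proof (rule pmf_eqI)
  fix x :: "'a \<times> 'b"
  have fst: "map_pmf fst ?P = p"
    by (simp add: map_bind_pmf pmf.map_comp comp_def bind_return_pmf')
  have ne: "set_pmf ?P \<inter> fst -` A \<noteq> {}"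
  proof -
    obtain w y where "w \<in> set_pmf p" "w \<in> A" "y \<in> set_pmf (k w)"
      using assms set_pmf_not_empty by fastforce
    hence "(w, y) \<in> set_pmf ?P \<inter> fst -` A" by auto
    thus ?thesis by blast
  qed
  \<comment> \<open>The first marginal is \<open>p\<close>, so both conditionings have the same
    normalising constant.\<close>
  have meas: "measure ?P (fst -` A) = measure p A"
    using arg_cong[OF fst, of "\<lambda>q. measure (measure_pmf q) A"] by simp
  show "pmf (cond_pmf ?P (fst -` A)) x = pmf (bind_pmf (cond_pmf p A) ?k) x"
    unfolding pmf_cond[OF ne] meas
    by (cases x) (simp add: pmf_bind_Pair pmf_cond[OF assms])
qed

text \<open>Any product form of the joint law suffices, as its factors are forced to be the
  marginals.\<close>

lemma indep_rv_pair_pmf: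
  assumes "map_pmf (\<lambda>w. (S w, T w)) p = pair_pmf M N"
  shows "indep_rv p S T"
proof -
  have "map_pmf S p = map_pmf fst (map_pmf (\<lambda>w. (S w, T w)) p)"
    "map_pmf T p = map_pmf snd (map_pmf (\<lambda>w. (S w, T w)) p)"
    by (simp_all add: pmf.map_comp comp_def)
  hence "map_pmf S p = M" "map_pmf T p = N"
    by (simp_all add: assms map_fst_pair_pmf map_snd_pair_pmf)
  thus ?thesis by (simp add: indep_rv_def assms pmf_pair)
qed

text \<open>Given \<open>u = c\<close>, the law of \<open>f\<close> under the kernel is the constant
  \<open>g c\<close>, whatever the sample, so it carries no information about
  \<open>s\<close>.\<close>

lemma cond_indep_rv_kernel:
  assumes g: "\<And>w. w \<in> set_pmf p \<Longrightarrow> map_pmf f (k w) = g (u w)"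
  shows "cond_indep_rv (bind_pmf p (\<lambda>w. map_pmf (Pair w) (k w)))
           (\<lambda>x. f (snd x)) (\<lambda>x. s (fst x)) (\<lambda>x. u (fst x))"
  unfolding cond_indep_rv_def
proof (intro ballI)
  let ?P = "bind_pmf p (\<lambda>w. map_pmf (Pair w) (k w))"
  fix c assume "c \<in> set_pmf (map_pmf (\<lambda>x. u (fst x)) ?P)"
  hence ne: "set_pmf p \<inter> {w. u w = c} \<noteq> {}" by auto
  let ?q = "cond_pmf p {w. u w = c}"
  have "map_pmf (\<lambda>x. (f (snd x), s (fst x))) (cond_pmf ?P (fst -` {w. u w = c})) =
      bind_pmf ?q (\<lambda>w. map_pmf (\<lambda>y. (y, s w)) (map_pmf f (k w)))"
    unfolding cond_pmf_bind_Pair[OF ne] by (simp add: map_bind_pmf pmf.map_comp comp_def)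
  also have "\<dots> = bind_pmf ?q (\<lambda>w. map_pmf (\<lambda>y. (y, s w)) (g c))"
    using g by (intro bind_pmf_cong) (auto simp: set_cond_pmf[OF ne])
  also have "\<dots> = bind_pmf (map_pmf s ?q) (\<lambda>b. map_pmf (\<lambda>y. (y, b)) (g c))"
    by (simp add: bind_map_pmf)
  \<comment> \<open>The second draw no longer depends on the first, so the two may be
    exchanged.\<close>
  also have "\<dots> = pair_pmf (g c) (map_pmf s ?q)"
    unfolding pair_pmf_def map_pmf_def[of _ "g c"] by (rule bind_commute_pmf)
  finally show "indep_rv (cond_pmf ?P {x. u (fst x) = c}) (\<lambda>x. f (snd x)) (\<lambda>x. s (fst x))"
    unfolding vimage_def mem_Collect_eq by (rule indep_rv_pair_pmf)
qed


section \<open>Relative tightness\<close>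

text \<open>Having a truth value means being defined, hence almost sure totality, which for a
  \<open>pmf\<close> means totality on the whole carrier.\<close>

lemma sat_total:
  assumes "semantic_assertion \<Phi>" "sat p S \<Phi>" "w \<in> set_pmf p"
  shows "FV \<Phi> \<subseteq> fmdom' (S w)"
proof -
  let ?e = "to_nat_on (set_pmf p)" and ?d = "from_nat_into (set_pmf p)"
  have "\<Phi> (map_pmf ?e p) (S \<circ> ?d) \<noteq> None"
    using assms(2) by (simp add: sat_def assn_value_def)
  hence "total_rs (FV \<Phi>) (map_pmf ?e p) (S \<circ> ?d)"
    using is_FV_FV[OF assms(1)] unfolding is_FV_def by blast
  hence "FV \<Phi> \<subseteq> fmdom' (S (?d (?e w)))"
    using assms(3) by (simp add: total_rs_def AE_measure_pmf_iff total_state_def)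
  thus ?thesis using assms(3) by (simp add: countable_set_pmf)
qed

text \<open>The restricted random state is still total on \<open>FV \<Phi>\<close>, so
  \<open>\<Phi>\<close> is defined there, and monotonicity carries its value to \<open>S\<close>
  unchanged.\<close>

lemma sat_restrict:
  assumes "semantic_assertion \<Phi>" "sat p S \<Phi>"
  shows "sat p (\<lambda>w. fmrestrict_set (FV \<Phi>) (S w)) \<Phi>"
proof -
  let ?e = "to_nat_on (set_pmf p)" and ?d = "from_nat_into (set_pmf p)"
  let ?S = "\<lambda>w. fmrestrict_set (FV \<Phi>) (S w)"
  have "total_rs (FV \<Phi>) (map_pmf ?e p) (?S \<circ> ?d)"
    using sat_total[OF assms]
    by (auto simp: total_rs_def AE_measure_pmf_iff total_state_def countable_set_pmf subset_iff
        fmlookup_dom'_iff)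
  hence "\<Phi> (map_pmf ?e p) (?S \<circ> ?d) \<noteq> None"
    using is_FV_FV[OF assms(1)] unfolding is_FV_def by blast
  moreover have "\<forall>w \<in> set_pmf (map_pmf ?e p). (?S \<circ> ?d) w \<subseteq>\<^sub>f (S \<circ> ?d) w"
    by (simp add: fmrestrict_set_fmsubset)
  ultimately have "\<Phi> (map_pmf ?e p) (?S \<circ> ?d) = \<Phi> (map_pmf ?e p) (S \<circ> ?d)"
    using assms(1) unfolding semantic_assertion_def by blast
  with assms(2) show ?thesis by (simp add: sat_def assn_value_def)
qed

text \<open>\<open>partially_correct\<close> speaks of sample spaces over the natural numbers;
  enumerating the carrier transfers it to any type.\<close>

lemma partially_correct_fault_free:
  assumes "semantic_assertion \<Phi>" "partially_correct \<Phi> C \<Psi>" "sat p S \<Phi>"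
  shows "fault_free_rs C p S"
proof -
  let ?e = "to_nat_on (set_pmf p)" and ?d = "from_nat_into (set_pmf p)"
  have "sat (map_pmf ?e p) (S \<circ> ?d) \<Phi>"
    using assms(3) by (simp add: sat_def assn_value_nat[OF assms(1)]) (simp add: assn_value_def)
  with assms(2) have "fault_free_rs C (map_pmf ?e p) (S \<circ> ?d)"
    by (simp add: partially_correct_def)
  thus ?thesis by (simp add: fault_free_rs_def countable_set_pmf)
qed

text \<open>The postcondition makes the termination random state total on the carrier, and every
  terminal path from a carrier point belongs to that carrier.\<close>

lemma partially_correct_total:
  assumes "semantic_assertion \<Phi>" "semantic_assertion \<Psi>" "partially_correct \<Phi> C \<Psi>"
    and "sat p S \<Phi>" "terminating_rs C p S"
    and w: "w \<in> set_pmf p" and \<pi>: "\<pi> \<in> term_paths C (S w)"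
  shows "FV \<Psi> \<subseteq> fmdom' (final \<pi>)"
proof -
  let ?e = "to_nat_on (set_pmf p)" and ?d = "from_nat_into (set_pmf p)"
  have "sat (map_pmf ?e p) (S \<circ> ?d) \<Phi>"
    using assms(4) by (simp add: sat_def assn_value_nat[OF assms(1)]) (simp add: assn_value_def)
  moreover have terminating: "terminating_rs C (map_pmf ?e p) (S \<circ> ?d)"
    using assms(5) by (simp add: terminating_rs_def countable_set_pmf)
  ultimately have "sat (term_space C (map_pmf ?e p) (S \<circ> ?d)) term_rs \<Psi>"
    using assms(3) by (simp add: partially_correct_def)
  moreover have "(?e w, \<pi>) \<in> set_pmf (term_space C (map_pmf ?e p) (S \<circ> ?d))"
    using w \<pi> by (simp add: set_pmf_term_space[OF terminating] countable_set_pmf)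
  ultimately have "FV \<Psi> \<subseteq> fmdom' (term_rs (?e w, \<pi>))"
    by (rule sat_total[OF assms(2)])
  thus ?thesis by (simp add: term_rs_def)
qed

theorem theorem6p3:
  fixes \<Phi> \<Psi> :: "'v sassn" and C :: "'v com"
    and \<Omega> :: "'w pmf" and \<Sigma> :: "'w \<Rightarrow> 'v state"
  assumes "infinite (UNIV :: 'v set)"
    and "semantic_assertion \<Phi>" and "semantic_assertion \<Psi>"
    and "partially_correct \<Phi> C \<Psi>"
    and "sat \<Omega> \<Sigma> \<Phi>"
    and "terminating_rs C \<Omega> \<Sigma>"
  shows "cond_indep_rv (term_space C \<Omega> \<Sigma>)
           (\<lambda>x. fmrestrict_set (FV \<Psi>) (term_rs x))
           (\<Sigma> \<circ> term_proj)
           ((\<lambda>w. fmrestrict_set (FV \<Phi>) (\<Sigma> w)) \<circ> term_proj)"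
proof -
  let ?\<Sigma> = "\<lambda>w. fmrestrict_set (FV \<Phi>) (\<Sigma> w)"
  let ?F = "\<lambda>\<pi>. fmrestrict_set (FV \<Psi>) (final \<pi>)"
  have sat: "sat \<Omega> ?\<Sigma> \<Phi>"
    using assms(2,5) by (rule sat_restrict)
  have ff: "fault_free_rs C \<Omega> ?\<Sigma>"
    using assms(2,4) sat by (rule partially_correct_fault_free)
  have terminating: "terminating_rs C \<Omega> ?\<Sigma>"
    unfolding terminating_rs_def
  proof
    fix w assume "w \<in> set_pmf \<Omega>"
    with ff assms(6) have "fault_free C (?\<Sigma> w)" "terminating C (\<Sigma> w)"
      by (simp_all add: fault_free_rs_def terminating_rs_def)
    with fmrestrict_set_fmsubset show "terminating C (?\<Sigma> w)" by (rule terminating_lower)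
  qed
  have "map_pmf ?F (path_pmf C (\<Sigma> w)) = map_pmf ?F (path_pmf C (?\<Sigma> w))"
    if w: "w \<in> set_pmf \<Omega>" for w
  proof (rule map_final_path_pmf[OF fmrestrict_set_fmsubset])
    show "fault_free C (?\<Sigma> w)" "terminating C (\<Sigma> w)"
      using w ff assms(6) by (simp_all add: fault_free_rs_def terminating_rs_def)
    show "FV \<Psi> \<subseteq> fmdom' (final \<pi>)" if "\<pi> \<in> term_paths C (?\<Sigma> w)" for \<pi>
      using assms(2,3,4) sat terminating w that by (rule partially_correct_total)
  qed
  \<comment> \<open>The kernel starts from the full state and \<open>g\<close> from the restricted
    one; the equality just proved says that their outcome laws agree on the carrier.\<close>
  from cond_indep_rv_kernel[where k = "\<lambda>w. path_pmf C (\<Sigma> w)" and u = ?\<Sigma> and f = ?F and s = \<Sigma>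
      and g = "\<lambda>\<sigma>. map_pmf ?F (path_pmf C \<sigma>)", OF this]
  show ?thesis
    by (simp add: term_space_bind[OF assms(6)] term_rs_def term_proj_def comp_def case_prod_beta)
qed

end
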